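(* Let $T_1,T_2,T_3\in\mathcal{B}_A(\mathcal{H})$ and let $i$ denote the imaginary unit when it multiplies an operator. Then $$w_{\mathbb{A}}\left(\begin{bmatrix}T_1&T_2&T_3\\ T_2&T_3&-iT_1\\ T_3&-iT_1&-iT_2\end{bmatrix}\right)\le w_A(T_3)+\max\{w_A(T_1),w_A(T_2)\}+\frac1{\sqrt2}\left(\|T_1-T_2\|_A+\|T_1+T_2\|_A\right).$$
   Context: $\mathcal{H}$ is a complex Hilbert space with inner product $\langle\cdot,\cdot\rangle$, $\mathcal{B}(\mathcal{H})$ is the algebra of bounded linear operators on $\mathcal{H}$, and $A\in\mathcal{B}(\mathcal{H})$ is a fixed positive operator ($\langle Ax,x\rangle\ge 0$ for all $x$). Put $\langle x,y\rangle_A=\langle Ax,y\rangle$ and $\|x\|_A=\sqrt{\langle x,x\rangle_A}$. $\mathcal{B}_A(\mathcal{H})$ is the set of $T\in\mathcal{B}(\mathcal{H})$ admitting an $A$-adjoint, i.e. for which there is $X\in\mathcal{B}(\mathcal{H})$ with $AX=T^*A$ (equivalently $\mathcal{R}(T^*A)\subseteq\mathcal{R}(A)$). The $A$-operator seminorm is $\|T\|_A=\sup_{x\in\overline{\mathcal{R}(A)},\,x\ne0}\|Tx\|_A/\|x\|_A$ and the $A$-numerical radius is $w_A(T)=\sup\{|\langle Tx,x\rangle_A|: x\in\mathcal{H},\ \|x\|_A=1\}$. $\mathbb{A}$ denotes the $3\times3$ block diagonal operator matrix on $\mathcal{H}\oplus\mathcal{H}\oplus\mathcal{H}$ with all diagonal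 entries $A$, and $w_{\mathbb{A}}$ is the numerical radius defined in the same way with $\mathcal{H},A$ replaced by $\mathcal{H}\oplus\mathcal{H}\oplus\mathcal{H},\mathbb{A}$. *)

theory Defs
  imports "HOL-Analysis.Analysis"
begin

text \<open>The inner product is linear in the first argument and conjugate linear in the second.\<close>

class complex_inner = real_normed_vector +
  fixes scaleC :: "complex \<Rightarrow> 'a \<Rightarrow> 'a" (infixr \<open>*\<^sub>C\<close> 75)
    and cinner :: "'a \<Rightarrow> 'a \<Rightarrow> complex"
  assumes scaleC_add_right: "c *\<^sub>C (x + y) = c *\<^sub>C x + c *\<^sub>C y"
    and scaleC_add_left: "(c + d) *\<^sub>C x = c *\<^sub>C x + d *\<^sub>C x"
    and scaleC_scaleC: "c *\<^sub>C d *\<^sub>C x = (c * d) *\<^sub>C x"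
    and scaleR_scaleC: "r *\<^sub>R x = complex_of_real r *\<^sub>C x"
    and cinner_commute: "cinner x y = cnj (cinner y x)"
    and cinner_add_left: "cinner (x + y) z = cinner x z + cinner y z"
    and cinner_scaleC_left: "cinner (c *\<^sub>C x) y = c * cinner x y"
    and cinner_ge_zero: "0 \<le> Re (cinner x x)"
    and norm_eq_sqrt_cinner: "norm x = sqrt (Re (cinner x x))"

class chilbert_space = complex_inner + complete_space

instantiation complex :: chilbert_space
begin

definition scaleC_complex :: "complex \<Rightarrow> complex \<Rightarrow> complex"
  where "scaleC_complex c x = c * x"

definition cinner_complex :: "complex \<Rightarrow> complex \<Rightarrow> complex"
  where "cinner_complex x y = x * cnj y"

instance
  by standard
    (auto simp: scaleC_complex_def cinner_complex_def algebra_simps scaleR_conv_of_real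
      cmod_def power2_eq_square)

end

text \<open>The orthogonal direct sum of two Hilbert spaces; the norm, and hence the topology, is the
  one the library already puts on the product type.\<close>

instantiation prod :: (complex_inner, complex_inner) complex_inner
begin

definition scaleC_prod :: "complex \<Rightarrow> 'a \<times> 'b \<Rightarrow> 'a \<times> 'b"
  where "scaleC_prod c x = (c *\<^sub>C fst x, c *\<^sub>C snd x)"

definition cinner_prod :: "'a \<times> 'b \<Rightarrow> 'a \<times> 'b \<Rightarrow> complex"
  where "cinner_prod x y = cinner (fst x) (fst y) + cinner (snd x) (snd y)"

instance
proof
  fix x y :: "'a \<times> 'b"
  show "cinner x y = cnj (cinner y x)"
    unfolding cinner_prod_def complex_cnj_add by (metis cinner_commute)
  show "norm x = sqrt (Re (cinner x x))"
    by (simp add: norm_prod_def cinner_prod_def norm_eq_sqrt_cinner cinner_ge_zero)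
qed (auto simp: scaleC_prod_def cinner_prod_def prod_eq_iff scaleC_add_right scaleC_add_left
    scaleC_scaleC scaleR_scaleC cinner_add_left cinner_scaleC_left cinner_ge_zero algebra_simps)

end

instance prod :: (chilbert_space, chilbert_space) chilbert_space ..

definition bounded_clinear :: "('a::complex_inner \<Rightarrow> 'b::complex_inner) \<Rightarrow> bool"
  where "bounded_clinear T \<longleftrightarrow> bounded_linear T \<and> (\<forall>c x. T (c *\<^sub>C x) = c *\<^sub>C T x)"

definition positive_op :: "('a::complex_inner \<Rightarrow> 'a) \<Rightarrow> bool"
  where "positive_op A \<longleftrightarrow> bounded_clinear A \<and> (\<forall>x. cinner (A x) x \<in> \<real>\<^sub>\<ge>\<^sub>0)"

definition cadjoint :: "('a::chilbert_space \<Rightarrow> 'b::chilbert_space) \<Rightarrow> 'b \<Rightarrow> 'a"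
  where "cadjoint T = (THE S. bounded_clinear S \<and> (\<forall>x y. cinner (T x) y = cinner x (S y)))"

definition A_inner :: "('a::complex_inner \<Rightarrow> 'a) \<Rightarrow> 'a \<Rightarrow> 'a \<Rightarrow> complex"
  where "A_inner A x y = cinner (A x) y"

definition A_norm :: "('a::complex_inner \<Rightarrow> 'a) \<Rightarrow> 'a \<Rightarrow> real"
  where "A_norm A x = sqrt (Re (A_inner A x x))"

definition A_adjointable :: "('a::chilbert_space \<Rightarrow> 'a) \<Rightarrow> ('a \<Rightarrow> 'a) set"
  where "A_adjointable A =
    {T. bounded_clinear T \<and> (\<exists>X. bounded_clinear X \<and> A \<circ> X = cadjoint T \<circ> A)}"

text \<open>In the next two definitions inserting \<open>0\<close> into a set of nonnegative numbers only matters
  when that set is empty, i.e. when \<open>A = 0\<close>; it makes the supremum \<open>0\<close> there, whereas the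
  library leaves \<open>Sup {}\<close> unspecified on the reals.\<close>

definition A_opnorm :: "('a::complex_inner \<Rightarrow> 'a) \<Rightarrow> ('a \<Rightarrow> 'a) \<Rightarrow> real"
  where "A_opnorm A T =
    Sup (insert 0 {A_norm A (T x) / A_norm A x |x. x \<in> closure (range A) \<and> x \<noteq> 0})"

definition A_numerical_radius :: "('a::complex_inner \<Rightarrow> 'a) \<Rightarrow> ('a \<Rightarrow> 'a) \<Rightarrow> real"
  where "A_numerical_radius A T =
    Sup (insert 0 {cmod (A_inner A (T x) x) |x. A_norm A x = 1})"

text \<open>The entries of the \<open>3 \<times> 3\<close> block operator matrix are listed row by row.\<close>

definition block3 ::
  "('a \<Rightarrow> 'a) \<Rightarrow> ('a \<Rightarrow> 'a) \<Rightarrow> ('a \<Rightarrow> 'a) \<Rightarrow>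
   ('a \<Rightarrow> 'a) \<Rightarrow> ('a \<Rightarrow> 'a) \<Rightarrow> ('a \<Rightarrow> 'a) \<Rightarrow>
   ('a \<Rightarrow> 'a) \<Rightarrow> ('a \<Rightarrow> 'a) \<Rightarrow> ('a \<Rightarrow> 'a) \<Rightarrow>
   'a \<times> 'a \<times> 'a \<Rightarrow> 'a \<times> 'a \<times> ('a::complex_inner)"
  where "block3 T11 T12 T13 T21 T22 T23 T31 T32 T33 = (\<lambda>(x, y, z).
    (T11 x + T12 y + T13 z,
     T21 x + T22 y + T23 z,
     T31 x + T32 y + T33 z))"

abbreviation zero_op :: "'a \<Rightarrow> 'a::complex_inner"
  where "zero_op \<equiv> (\<lambda>x. 0)"

definition diag3 :: "('a::complex_inner \<Rightarrow> 'a) \<Rightarrow> 'a \<times> 'a \<times> 'a \<Rightarrow> 'a \<times> 'a \<times> 'a"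
  where "diag3 A = block3 A zero_op zero_op zero_op A zero_op zero_op zero_op A"

end

theory Submission
  imports Defs
begin

text \<open>Write \<open>M\<close> for the block operator and \<open>S = T1 + T2\<close>, \<open>D = T1 - T2\<close>. The quadratic form of \<open>M\<close>
  at \<open>(x, y, z)\<close> splits into three pieces.

  The entries \<open>T3\<close> form a flip matrix with eigenvalues \<open>1\<close> and \<open>-1\<close>, so they contribute at most
  \<open>w\<^sub>A(T3)\<close>. The remaining diagonal entries \<open>T1\<close>, \<open>0\<close> and \<open>-\<i> T2\<close> contribute at most the maximum of
  \<open>w\<^sub>A(T1)\<close> and \<open>w\<^sub>A(T2)\<close>. The off-diagonal entries \<open>T2\<close> and \<open>-\<i> T1\<close> couple \<open>y\<close> to \<open>x\<close> and \<open>z\<close>;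
  substituting \<open>T1 = (S + D)/2\<close> and \<open>T2 = (S - D)/2\<close> turns the coupling into pairings of \<open>y\<close> with
  \<open>x + \<i> z\<close> and \<open>x - \<i> z\<close> through \<open>S\<close> and \<open>D\<close>. Cauchy--Schwarz and the parallelogram law then bound it
  by half the sum of the two seminorms, and \<open>1/2 \<le> 1/\<surd>2\<close>. These are \<open>flip_form_bound\<close> and
  \<open>cross_form_bound\<close>.

  The analytic content is that the suprema really are bounds: \<open>\<bar>\<langle>T x, x\<rangle>\<^sub>A\<bar> \<le> w\<^sub>A(T) \<parallel>x\<parallel>\<^sub>A\<^sup>2\<close> and
  \<open>\<parallel>T x\<parallel>\<^sub>A \<le> \<parallel>T\<parallel>\<^sub>A \<parallel>x\<parallel>\<^sub>A\<close> for every \<open>x\<close>. A real supremum says nothing about an unbounded set, so \<open>T\<close>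
  has to be bounded for the seminorm first (\<open>A_adjointable_imp_A_bounded\<close>); this follows from the
  existence of an \<open>A\<close>-adjoint by Krein's argument. The seminorm of \<open>T\<close> moreover tests only vectors
  in \<open>closure (range A)\<close>, and \<open>range_A_dense\<close> carries its bound over to the whole space.\<close>

section \<open>Complex inner product spaces\<close>

lemma cinner_add_right: "cinner x (y + z) = cinner x y + cinner x z"
  by (metis cinner_commute cinner_add_left complex_cnj_add)

lemma cinner_scaleC_right: "cinner x (c *\<^sub>C y) = cnj c * cinner x y"
  by (metis cinner_commute cinner_scaleC_left complex_cnj_mult)

lemma cinner_scaleR_left: "cinner (r *\<^sub>R x) y = of_real r * cinner x y"
  by (simp add: scaleR_scaleC cinner_scaleC_left)

lemma cinner_scaleR_right: "cinner x (r *\<^sub>R y) = of_real r * cinner x y"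
  by (simp add: scaleR_scaleC cinner_scaleC_right)

lemma cinner_minus_left: "cinner (- x) y = - cinner x y"
  using cinner_scaleR_left[of "-1" x y] by simp

lemma cinner_minus_right: "cinner x (- y) = - cinner x y"
  using cinner_scaleR_right[of x "-1" y] by simp

lemma cinner_diff_left: "cinner (x - y) z = cinner x z - cinner y z"
  using cinner_add_left[of x "- y" z] by (simp add: cinner_minus_left)

lemma cinner_diff_right: "cinner x (y - z) = cinner x y - cinner x z"
  using cinner_add_right[of x y "- z"] by (simp add: cinner_minus_right)

lemma cinner_zero_left: "cinner 0 y = 0"
  using cinner_scaleR_left[of 0 0 y] by simp

lemma cinner_zero_right: "cinner x 0 = 0"
  using cinner_scaleR_right[of x 0 0] by simp

lemmas cinner_simps = cinner_add_left cinner_add_right cinner_diff_left cinner_diff_right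
  cinner_scaleC_left cinner_scaleC_right cinner_scaleR_left cinner_scaleR_right
  cinner_minus_left cinner_minus_right cinner_zero_left cinner_zero_right

lemma cinner_self: "cinner x x = of_real ((norm x)\<^sup>2)"
proof -
  have "Im (cinner x x) = 0"
    using arg_cong[OF cinner_commute[of x x], of Im] by simp
  moreover have "Re (cinner x x) = (norm x)\<^sup>2"
    by (simp add: norm_eq_sqrt_cinner cinner_ge_zero)
  ultimately show ?thesis
    by (simp add: complex_eq_iff)
qed

lemma cinner_ext:
  assumes "\<And>z. cinner z x = cinner z y"
  shows "x = y"
proof -
  have "cinner (x - y) (x - y) = 0"
    using assms[of "x - y"] by (simp add: cinner_diff_right)
  then show ?thesis
    by (simp add: cinner_self)
qed

lemma bounded_clinear_add: "bounded_clinear T \<Longrightarrow> T (x + y) = T x + T y"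
  by (simp add: bounded_clinear_def linear_simps)

lemma bounded_clinear_diff: "bounded_clinear T \<Longrightarrow> T (x - y) = T x - T y"
  by (simp add: bounded_clinear_def linear_simps)

lemma bounded_clinear_zero: "bounded_clinear T \<Longrightarrow> T 0 = 0"
  by (simp add: bounded_clinear_def linear_simps)

lemma bounded_clinear_scaleR: "bounded_clinear T \<Longrightarrow> T (r *\<^sub>R x) = r *\<^sub>R T x"
  by (simp add: bounded_clinear_def linear_simps)

lemma bounded_clinear_scaleC: "bounded_clinear T \<Longrightarrow> T (c *\<^sub>C x) = c *\<^sub>C T x"
  by (simp add: bounded_clinear_def)

lemmas bounded_clinear_simps = bounded_clinear_add bounded_clinear_diff bounded_clinear_zero
  bounded_clinear_scaleR bounded_clinear_scaleC

lemma bounded_clinear_pos_bound: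
  assumes "bounded_clinear T"
  obtains K where "K > 0" "\<And>x. norm (T x) \<le> K * norm x"
  using assms bounded_linear.pos_bounded[of T]
  by (metis bounded_clinear_def mult.commute)

lemma bounded_clinear_compose:
  "bounded_clinear S \<Longrightarrow> bounded_clinear T \<Longrightarrow> bounded_clinear (\<lambda>x. S (T x))"
  using bounded_linear_compose by (auto simp: bounded_clinear_def)

lemma bounded_clinear_plus:
  "bounded_clinear S \<Longrightarrow> bounded_clinear T \<Longrightarrow> bounded_clinear (\<lambda>x. S x + T x)"
  by (auto simp: bounded_clinear_def scaleC_add_right intro: bounded_linear_add)

lemma scaleC_minus_right: "c *\<^sub>C (- x) = - (c *\<^sub>C x)"
  by (rule cinner_ext) (simp add: cinner_simps)

lemma bounded_clinear_minus:
  "bounded_clinear S \<Longrightarrow> bounded_clinear T \<Longrightarrow> bounded_clinear (\<lambda>x. S x - T x)"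
  using scaleC_add_right[of _ "S _" "- T _"]
  by (auto simp: bounded_clinear_def scaleC_minus_right intro: bounded_linear_sub)


section \<open>The semi-inner product of a positive operator\<close>

lemma A_inner_add_left: "bounded_clinear A \<Longrightarrow> A_inner A (x + y) z = A_inner A x z + A_inner A y z"
  by (simp add: A_inner_def bounded_clinear_simps cinner_simps)

lemma A_inner_diff_left: "bounded_clinear A \<Longrightarrow> A_inner A (x - y) z = A_inner A x z - A_inner A y z"
  by (simp add: A_inner_def bounded_clinear_simps cinner_simps)

lemma A_inner_scaleC_left: "bounded_clinear A \<Longrightarrow> A_inner A (c *\<^sub>C x) z = c * A_inner A x z"
  by (simp add: A_inner_def bounded_clinear_simps cinner_simps)

lemma A_inner_scaleR_left: "bounded_clinear A \<Longrightarrow> A_inner A (r *\<^sub>R x) z = of_real r * A_inner A x z"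
  by (simp add: A_inner_def bounded_clinear_simps cinner_simps)

lemma A_inner_add_right: "A_inner A x (y + z) = A_inner A x y + A_inner A x z"
  by (simp add: A_inner_def cinner_simps)

lemma A_inner_diff_right: "A_inner A x (y - z) = A_inner A x y - A_inner A x z"
  by (simp add: A_inner_def cinner_simps)

lemma A_inner_scaleC_right: "A_inner A x (c *\<^sub>C y) = cnj c * A_inner A x y"
  by (simp add: A_inner_def cinner_simps)

lemma A_inner_scaleR_right: "A_inner A x (r *\<^sub>R y) = of_real r * A_inner A x y"
  by (simp add: A_inner_def cinner_simps)

lemmas A_inner_simps = A_inner_add_left A_inner_diff_left A_inner_scaleC_left A_inner_scaleR_left
  A_inner_add_right A_inner_diff_right A_inner_scaleC_right A_inner_scaleR_right

lemma positive_op_bounded_clinear: "positive_op A \<Longrightarrow> bounded_clinear A"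
  by (simp add: positive_op_def)

lemma A_inner_self:
  assumes "positive_op A"
  shows "A_inner A x x = of_real ((A_norm A x)\<^sup>2)"
proof -
  have "cinner (A x) x \<in> \<real>\<^sub>\<ge>\<^sub>0"
    using assms by (simp add: positive_op_def)
  then show ?thesis
    by (auto simp: A_norm_def A_inner_def complex_nonneg_Reals_iff complex_eq_iff)
qed

lemma A_norm_nonneg: "positive_op A \<Longrightarrow> 0 \<le> A_norm A x"
  by (auto simp: positive_op_def A_norm_def A_inner_def complex_nonneg_Reals_iff)

text \<open>On a complex space reality of the quadratic form already forces Hermitian symmetry: this is
  polarization, read off from the values at \<open>x + y\<close> and \<open>x + \<i> y\<close>.\<close>

lemma A_inner_commute:
  assumes "positive_op A"
  shows "A_inner A x y = cnj (A_inner A y x)"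
proof -
  note A = positive_op_bounded_clinear[OF assms]
  have real: "Im (A_inner A z z) = 0" for z
    by (simp add: A_inner_self[OF assms])
  have "Im (A_inner A x y) + Im (A_inner A y x) = 0"
    using real[of "x + y"] real[of x] real[of y] by (simp add: A_inner_simps A)
  moreover have "Re (A_inner A y x) = Re (A_inner A x y)"
    using real[of "x + \<i> *\<^sub>C y"] real[of x] real[of y] by (simp add: A_inner_simps A)
  ultimately show ?thesis
    by (simp add: complex_eq_iff)
qed

lemma A_norm_sq_add:
  assumes "positive_op A"
  shows "(A_norm A (x + y))\<^sup>2 = (A_norm A x)\<^sup>2 + 2 * Re (A_inner A x y) + (A_norm A y)\<^sup>2"
proof -
  have "of_real ((A_norm A (x + y))\<^sup>2)
      = of_real ((A_norm A x)\<^sup>2) + (A_inner A x y + A_inner A y x) + of_real ((A_norm A y)\<^sup>2)"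
    unfolding A_inner_self[OF assms, symmetric]
    using positive_op_bounded_clinear[OF assms] by (simp add: A_inner_simps)
  from arg_cong[OF this, of Re] show ?thesis
    using A_inner_commute[OF assms, of y x] by simp
qed

lemma A_norm_scaleC:
  assumes "positive_op A"
  shows "A_norm A (c *\<^sub>C x) = cmod c * A_norm A x"
proof -
  have "A_inner A (c *\<^sub>C x) (c *\<^sub>C x) = (c * cnj c) * A_inner A x x"
    using positive_op_bounded_clinear[OF assms] by (simp add: A_inner_simps)
  also have "\<dots> = of_real ((cmod c * A_norm A x)\<^sup>2)"
    by (simp add: A_inner_self[OF assms] power_mult_distrib flip: complex_norm_square)
  finally have "(A_norm A (c *\<^sub>C x))\<^sup>2 = (cmod c * A_norm A x)\<^sup>2"
    unfolding A_inner_self[OF assms] by (simp only: of_real_eq_iff)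
  then show ?thesis
    using A_norm_nonneg[OF assms] by (simp add: power2_eq_iff_nonneg)
qed

lemma A_norm_scaleR:
  "positive_op A \<Longrightarrow> A_norm A (r *\<^sub>R x) = \<bar>r\<bar> * A_norm A x"
  by (simp add: scaleR_scaleC A_norm_scaleC)

lemma A_norm_uminus: "positive_op A \<Longrightarrow> A_norm A (- x) = A_norm A x"
  using A_norm_scaleR[of A "-1" x] by simp

lemma A_norm_sq_diff:
  assumes "positive_op A"
  shows "(A_norm A (x - y))\<^sup>2 = (A_norm A x)\<^sup>2 - 2 * Re (A_inner A x y) + (A_norm A y)\<^sup>2"
  using A_norm_sq_add[OF assms, of x "- y"] A_norm_uminus[OF assms, of y]
  by (simp add: A_inner_def cinner_minus_right)

lemma A_parallelogram:
  assumes "positive_op A"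
  shows "(A_norm A (x + y))\<^sup>2 + (A_norm A (x - y))\<^sup>2 = 2 * ((A_norm A x)\<^sup>2 + (A_norm A y)\<^sup>2)"
  by (simp add: A_norm_sq_add[OF assms] A_norm_sq_diff[OF assms])

lemma A_Cauchy_Schwarz:
  assumes "positive_op A"
  shows "cmod (A_inner A x y) \<le> A_norm A x * A_norm A y"
proof -
  define b where "b = A_inner A x y"
  have quadratic: "0 \<le> (A_norm A x)\<^sup>2 - 2 * t * (cmod b)\<^sup>2 + t\<^sup>2 * (cmod b)\<^sup>2 * (A_norm A y)\<^sup>2" for t
  proof -
    have "0 \<le> (A_norm A (x - (of_real t * b) *\<^sub>C y))\<^sup>2"
      by simp
    also have "\<dots> = (A_norm A x)\<^sup>2 - 2 * Re (of_real t * (b * cnj b)) + (\<bar>t\<bar> * cmod b * A_norm A y)\<^sup>2"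
      by (simp add: A_norm_sq_diff[OF assms] A_norm_scaleC[OF assms] A_inner_scaleC_right
          norm_mult flip: b_def) (simp add: algebra_simps)
    also have "\<dots> = (A_norm A x)\<^sup>2 - 2 * t * (cmod b)\<^sup>2 + t\<^sup>2 * (cmod b)\<^sup>2 * (A_norm A y)\<^sup>2"
      by (simp add: complex_mult_cnj cmod_power2 power_mult_distrib flip: complex_norm_square)
    finally show ?thesis .
  qed
  have "(cmod b)\<^sup>2 \<le> (A_norm A x)\<^sup>2 * (A_norm A y)\<^sup>2"
  proof (cases "A_norm A y = 0")
    case True
    have "b = 0"
    proof (rule ccontr)
      assume "b \<noteq> 0"
      then have "0 \<le> (A_norm A x)\<^sup>2 - 2 * ((A_norm A x)\<^sup>2 + 1)"
        using quadratic[of "((A_norm A x)\<^sup>2 + 1) / (cmod b)\<^sup>2"] True by simp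
      then show False
        by (smt (verit) zero_le_power2)
    qed
    then show ?thesis
      by simp
  next
    case False
    then show ?thesis
      using quadratic[of "1 / (A_norm A y)\<^sup>2"]
      by (auto simp: field_simps power2_eq_square zero_le_divide_iff zero_le_mult_iff mult_le_0_iff)
  qed
  then have "(cmod b)\<^sup>2 \<le> (A_norm A x * A_norm A y)\<^sup>2"
    by (simp add: power_mult_distrib)
  then show ?thesis
    unfolding b_def using A_norm_nonneg[OF assms] by (meson mult_nonneg_nonneg power2_le_imp_le)
qed

lemma A_norm_triangle:
  assumes "positive_op A"
  shows "A_norm A (x + y) \<le> A_norm A x + A_norm A y"
proof (rule power2_le_imp_le)
  have "Re (A_inner A x y) \<le> A_norm A x * A_norm A y"
    using A_Cauchy_Schwarz[OF assms] complex_Re_le_cmod order_trans by blast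
  then show "(A_norm A (x + y))\<^sup>2 \<le> (A_norm A x + A_norm A y)\<^sup>2"
    by (simp add: A_norm_sq_add[OF assms] power2_sum)
qed (simp add: A_norm_nonneg[OF assms])

lemma A_norm_triangle_diff:
  "positive_op A \<Longrightarrow> A_norm A (x - y) \<le> A_norm A x + A_norm A y"
  using A_norm_triangle[of A x "- y"] by (simp add: A_norm_uminus)

lemma positive_op_id: "positive_op (\<lambda>x. x)"
  by (simp add: positive_op_def bounded_clinear_def bounded_linear_ident cinner_self)

lemma A_norm_id: "A_norm (\<lambda>x. x) x = norm x"
  by (simp add: A_norm_def A_inner_def norm_eq_sqrt_cinner)

lemma cinner_Cauchy_Schwarz: "cmod (cinner x y) \<le> norm x * norm y"
  using A_Cauchy_Schwarz[OF positive_op_id, of x y] by (simp add: A_norm_id A_inner_def)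

lemma A_norm_le_norm:
  assumes "positive_op A"
  obtains C where "C > 0" "\<And>x. A_norm A x \<le> C * norm x"
proof -
  obtain K where K: "K > 0" "\<And>x. norm (A x) \<le> K * norm x"
    using bounded_clinear_pos_bound[OF positive_op_bounded_clinear[OF assms]] by metis
  have "A_norm A x \<le> sqrt K * norm x" for x
  proof (rule power2_le_imp_le)
    have "(A_norm A x)\<^sup>2 = cmod (cinner (A x) x)"
      using A_inner_self[OF assms, of x] by (simp add: A_inner_def norm_power)
    also have "\<dots> \<le> (K * norm x) * norm x"
      using cinner_Cauchy_Schwarz[of "A x" x] mult_right_mono[OF K(2)[of x] norm_ge_zero[of x]]
      by linarith
    finally show "(A_norm A x)\<^sup>2 \<le> (sqrt K * norm x)\<^sup>2"
      using K(1) by (simp add: power_mult_distrib) (simp add: power2_eq_square)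
  qed (use K in simp)
  then show ?thesis
    using that[of "sqrt K"] K(1) by simp
qed

section \<open>Adjoints\<close>

text \<open>Adjoints are specified by a definite description, so nothing can be said about them before
  their existence is known, and this is where completeness enters.

  The representing vector is the minimizer of \<open>\<parallel>x\<parallel>\<^sup>2 - 2 Re (f x)\<close>. By the parallelogram law this
  functional is uniformly convex, so every minimizing sequence is Cauchy; completeness supplies
  the minimizer, and stationarity there is the representation.\<close>

lemma Riesz_representation:
  fixes f :: "'a::chilbert_space \<Rightarrow> complex"
  assumes f: "bounded_clinear f"
  shows "\<exists>v. \<forall>x. f x = cinner x v"
proof -
  obtain K where K: "K > 0" "\<And>x. cmod (f x) \<le> K * norm x"
    using bounded_clinear_pos_bound[OF f] by metis
  define J where "J x = (norm x)\<^sup>2 - 2 * Re (f x)" for x :: 'a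
  have norm_sq_add: "(norm (x + y))\<^sup>2 = (norm x)\<^sup>2 + 2 * Re (cinner x y) + (norm y)\<^sup>2" for x y :: 'a
    using A_norm_sq_add[OF positive_op_id, of x y] by (simp add: A_norm_id A_inner_def)
  have parallelogram: "(norm (x + y))\<^sup>2 + (norm (x - y))\<^sup>2 = 2 * ((norm x)\<^sup>2 + (norm y)\<^sup>2)" for x y :: 'a
    using A_parallelogram[OF positive_op_id, of x y] by (simp add: A_norm_id)
  have bdd: "bdd_below (range J)"
  proof (rule bdd_belowI2)
    fix x :: 'a
    have "0 \<le> (norm x - K)\<^sup>2"
      by simp
    moreover have "Re (f x) \<le> K * norm x"
      using K(2)[of x] complex_Re_le_cmod[of "f x"] by linarith
    ultimately show "- (K\<^sup>2) \<le> J x"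
      by (simp add: J_def power2_diff algebra_simps)
  qed
  define m where "m = Inf (range J)"
  have m_le: "m \<le> J x" for x
    unfolding m_def using bdd by (rule cINF_lower) simp
  have convex: "(norm (x - y))\<^sup>2 \<le> 2 * (J x - m) + 2 * (J y - m)" for x y
  proof -
    have "J ((1/2) *\<^sub>R (x + y)) = (norm (x + y))\<^sup>2 / 4 - Re (f x) - Re (f y)"
      using f by (simp add: J_def bounded_clinear_simps power_mult_distrib power2_eq_square)
        (simp add: scaleC_complex_def field_simps)
    then show ?thesis
      using m_le[of "(1/2) *\<^sub>R (x + y)"] parallelogram[of x y] by (simp add: J_def)
  qed
  have "\<exists>x. J x < m + 1 / real (Suc n)" for n
  proof -
    have "Inf (range J) < m + 1 / real (Suc n)"
      unfolding m_def by simp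
    then show ?thesis
      using cInf_lessD[of "range J"] by auto
  qed
  then obtain v where v: "\<And>n. J (v n) < m + 1 / real (Suc n)"
    by metis
  have "Cauchy v"
    unfolding Cauchy_def
  proof (intro allI impI)
    fix e :: real
    assume "e > 0"
    then have "0 < e\<^sup>2 / 4"
      by simp
    then obtain N where N: "1 / real (Suc N) < e\<^sup>2 / 4"
      using nat_approx_posE by metis
    have near: "J (v k) < m + e\<^sup>2 / 4" if "k \<ge> N" for k
    proof -
      have "1 / real (Suc k) \<le> 1 / real (Suc N)"
        using that by (simp add: frac_le)
      then have "m + 1 / real (Suc k) < m + e\<^sup>2 / 4"
        using N by (intro add_strict_left_mono) (rule le_less_trans)
      with v[of k] show ?thesis
        by (rule less_trans)
    qed
    show "\<exists>N. \<forall>i\<ge>N. \<forall>j\<ge>N. dist (v i) (v j) < e"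
    proof (intro exI allI impI)
      fix i j
      assume "i \<ge> N" "j \<ge> N"
      then have "(norm (v i - v j))\<^sup>2 < e\<^sup>2"
        using convex[of "v i" "v j"] near[of i] near[of j] by simp
      then show "dist (v i) (v j) < e"
        using \<open>e > 0\<close> by (simp add: dist_norm power2_less_imp_less)
    qed
  qed
  then obtain u where u: "v \<longlonglongrightarrow> u"
    using Cauchy_convergent_iff convergent_def by blast
  have "(\<lambda>n. f (v n)) \<longlonglongrightarrow> f u"
    using f u by (simp add: bounded_clinear_def bounded_linear.tendsto)
  then have "(\<lambda>n. J (v n)) \<longlonglongrightarrow> J u"
    unfolding J_def using u by (intro tendsto_intros)
  moreover have "(\<lambda>n. m + 1 / real (Suc n)) \<longlonglongrightarrow> m + 0"
    by (intro tendsto_intros LIMSEQ_Suc[OF lim_1_over_n])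
  ultimately have "J u \<le> m"
    using LIMSEQ_le[of "\<lambda>n. J (v n)" "J u" "\<lambda>n. m + 1 / real (Suc n)" m] v
    by (simp add: less_imp_le)
  then have minimal: "J u \<le> J x" for x
    using m_le[of x] by linarith
  have stationary: "Re (f y) = Re (cinner y u)" for y
  proof -
    define a where "a = Re (cinner u y) - Re (f y)"
    have quadratic: "0 \<le> 2 * t * a + t\<^sup>2 * (norm y)\<^sup>2" for t
      using minimal[of "u + t *\<^sub>R y"] f
      by (simp add: J_def a_def norm_sq_add cinner_simps bounded_clinear_simps power_mult_distrib
          scaleC_complex_def algebra_simps)
    \<comment> \<open>The value near the vertex would be negative; \<open>+ 1\<close> in the denominator covers \<open>y = 0\<close>.\<close>
    define t where "t = - a / ((norm y)\<^sup>2 + 1)"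
    have pos: "(norm y)\<^sup>2 + 1 > 0"
      by (simp add: add_nonneg_pos)
    then have a: "a = - t * ((norm y)\<^sup>2 + 1)"
      by (simp add: t_def)
    have "2 * t * a + t\<^sup>2 * (norm y)\<^sup>2 = - (t\<^sup>2 * ((norm y)\<^sup>2 + 2))"
      unfolding a by (simp add: power2_eq_square algebra_simps)
    then have "t\<^sup>2 * ((norm y)\<^sup>2 + 2) \<le> 0"
      using quadratic[of t] by simp
    then have "t = 0"
      by (smt (verit) mult_pos_pos zero_less_power2 zero_le_power2)
    then have "a = 0"
      using a by simp
    then show ?thesis
      using arg_cong[OF cinner_commute[of u y], of Re] by (simp add: a_def)
  qed
  \<comment> \<open>The imaginary part at \<open>y\<close> is minus the real part at \<open>\<i> y\<close>.\<close>
  have "f y = cinner y u" for y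
    using stationary[of y] stationary[of "\<i> *\<^sub>C y"] f
    by (simp add: complex_eq_iff bounded_clinear_simps cinner_simps scaleC_complex_def)
  then show ?thesis
    by blast
qed

lemma cadjoint_exists:
  fixes T :: "'a::chilbert_space \<Rightarrow> 'b::chilbert_space"
  assumes T: "bounded_clinear T"
  shows "\<exists>S. bounded_clinear S \<and> (\<forall>x y. cinner (T x) y = cinner x (S y))"
proof -
  obtain K where K: "K > 0" "\<And>x. norm (T x) \<le> K * norm x"
    using bounded_clinear_pos_bound[OF T] by metis
  have "\<exists>v. \<forall>x. cinner (T x) y = cinner x v" for y
  proof (rule Riesz_representation)
    have "cmod (cinner (T x) y) \<le> norm x * (K * norm y)" for x
      using cinner_Cauchy_Schwarz[of "T x" y] mult_right_mono[OF K(2)[of x] norm_ge_zero[of y]]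
      by (simp add: algebra_simps)
    then have "bounded_linear (\<lambda>x. cinner (T x) y)"
      using T by (intro bounded_linear_intro)
        (simp_all add: bounded_clinear_simps cinner_simps scaleR_conv_of_real)
    then show "bounded_clinear (\<lambda>x. cinner (T x) y)"
      using T by (simp add: bounded_clinear_def[of "\<lambda>x. cinner (T x) y"] bounded_clinear_simps
          cinner_simps scaleC_complex_def)
  qed
  then obtain S where S: "\<And>x y. cinner (T x) y = cinner x (S y)"
    by metis
  have "norm (S y) \<le> norm y * K" for y
  proof (cases "S y = 0")
    case False
    have "(norm (S y))\<^sup>2 = cmod (cinner (T (S y)) y)"
      by (simp add: S cinner_self norm_power)
    also have "\<dots> \<le> (K * norm (S y)) * norm y"
      using cinner_Cauchy_Schwarz[of "T (S y)" y] mult_right_mono[OF K(2)[of "S y"] norm_ge_zero[of y]]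
      by linarith
    finally show ?thesis
      using False by (simp add: power2_eq_square mult.assoc mult.left_commute mult.commute)
  qed (use K in simp)
  moreover have "S (x + y) = S x + S y" for x y
    by (rule cinner_ext) (simp add: cinner_simps flip: S)
  moreover have "S (r *\<^sub>R x) = r *\<^sub>R S x" for r x
    by (rule cinner_ext) (simp add: cinner_simps flip: S)
  ultimately have "bounded_linear S"
    by (intro bounded_linear_intro) auto
  moreover have "S (c *\<^sub>C x) = c *\<^sub>C S x" for c x
    by (rule cinner_ext) (simp add: cinner_simps flip: S)
  ultimately show ?thesis
    using S by (auto simp: bounded_clinear_def)
qed

lemma cinner_cadjoint:
  assumes "bounded_clinear T"
  shows "cinner (T x) y = cinner x (cadjoint T y)"
proof -
  have "\<exists>!S. bounded_clinear S \<and> (\<forall>x y. cinner (T x) y = cinner x (S y))"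
  proof (rule ex_ex1I[OF cadjoint_exists[OF assms]])
    fix S S'
    assume "bounded_clinear S \<and> (\<forall>x y. cinner (T x) y = cinner x (S y))"
      and "bounded_clinear S' \<and> (\<forall>x y. cinner (T x) y = cinner x (S' y))"
    then have "cinner z (S y) = cinner z (S' y)" for y z
      by simp
    then have "S y = S' y" for y
      by (rule cinner_ext)
    then show "S = S'" ..
  qed
  from theI'[OF this] show ?thesis
    unfolding cadjoint_def by blast
qed

lemma A_adjointable_adjoint:
  assumes A: "positive_op A" and T: "T \<in> A_adjointable A"
  obtains X where "bounded_clinear X" "\<And>x y. A_inner A (T x) y = A_inner A x (X y)"
proof -
  obtain X where X: "bounded_clinear X" "A \<circ> X = cadjoint T \<circ> A" and clin: "bounded_clinear T"
    using T by (auto simp: A_adjointable_def)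
  have self_adjoint: "cinner (A x) y = cinner x (A y)" for x y
    using A_inner_commute[OF A, of x y] cinner_commute[of x "A y"] by (simp add: A_inner_def)
  have "A_inner A (T x) y = A_inner A x (X y)" for x y
    using fun_cong[OF X(2), of y]
    by (simp add: A_inner_def self_adjoint cinner_cadjoint[OF clin])
  then show ?thesis
    using that X(1) by blast
qed

section \<open>Boundedness in the seminorm\<close>

definition A_bounded :: "('a::complex_inner \<Rightarrow> 'a) \<Rightarrow> ('a \<Rightarrow> 'a) \<Rightarrow> bool"
  where "A_bounded A T \<longleftrightarrow> (\<exists>M\<ge>0. \<forall>x. A_norm A (T x) \<le> M * A_norm A x)"

text \<open>The ratios \<open>a (n + 1) / a n\<close> of a log-convex sequence increase, so its first ratio is
  at most its exponential growth rate.\<close>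

lemma log_convex_first_ratio_le_growth:
  fixes a :: "nat \<Rightarrow> real"
  assumes nonneg: "\<And>n. 0 \<le> a n"
    and log_convex: "\<And>n. (a (Suc n))\<^sup>2 \<le> a n * a (Suc (Suc n))"
    and growth: "\<And>n. a n \<le> C * K ^ n" and K: "K > 0"
  shows "a 1 \<le> K * a 0"
proof (rule ccontr)
  assume less: "\<not> ?thesis"
  have "a 0 \<noteq> 0"
    using log_convex[of 0] less by auto
  then have a0: "a 0 > 0"
    using nonneg[of 0] by simp
  define r where "r = a 1 / a 0"
  have r: "r > K"
    using less a0 by (simp add: r_def field_simps)
  have "a n > 0 \<and> r * a n \<le> a (Suc n)" for n
  proof (induction n)
    case 0
    then show ?case
      using a0 by (simp add: r_def)
  next
    case (Suc n)
    then have pos: "a (Suc n) > 0"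
      using r K by (smt (verit) mult_pos_pos)
    have "a n * (r * a (Suc n)) = (r * a n) * a (Suc n)"
      by simp
    also have "\<dots> \<le> a (Suc n) * a (Suc n)"
      using Suc pos by (intro mult_right_mono) auto
    also have "\<dots> \<le> a n * a (Suc (Suc n))"
      using log_convex[of n] by (simp add: power2_eq_square)
    finally show ?case
      using Suc pos by simp
  qed
  note step = this
  have lower: "r ^ n * a 0 \<le> a n" for n
  proof (induction n)
    case (Suc n)
    have "r ^ Suc n * a 0 \<le> r * a n"
      using mult_left_mono[OF Suc, of r] r K by (simp add: mult.assoc)
    then show ?case
      using step[of n] by linarith
  qed simp
  obtain n where n: "C / a 0 < (r / K) ^ n"
    using real_arch_pow[of "r / K" "C / a 0"] r K by auto
  have "r ^ n * a 0 \<le> C * K ^ n"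
    using lower[of n] growth[of n] by linarith
  then have "(r / K) ^ n \<le> C / a 0"
    using a0 K by (simp add: power_divide field_simps)
  with n show False
    by simp
qed

text \<open>This is Krein's theorem on symmetrizable operators: \<open>\<parallel>P\<^sup>n x\<parallel>\<^sub>A\<close> is log-convex in \<open>n\<close> by Cauchy--Schwarz, and it grows
  at most like \<open>K\<^sup>n\<close> because the seminorm is dominated by the norm.\<close>

lemma symmetric_imp_A_bounded:
  assumes A: "positive_op A" and P: "bounded_clinear P"
    and symmetric: "\<And>x y. A_inner A (P x) y = A_inner A x (P y)"
  shows "A_bounded A P"
proof -
  obtain C where C: "C > 0" "\<And>x. A_norm A x \<le> C * norm x"
    using A_norm_le_norm[OF A] by metis
  obtain K where K: "K > 0" "\<And>x. norm (P x) \<le> K * norm x"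
    using bounded_clinear_pos_bound[OF P] by metis
  have "A_norm A (P x) \<le> K * A_norm A x" for x
  proof -
    define a where "a n = A_norm A ((P ^^ n) x)" for n
    have "a 1 \<le> K * a 0"
    proof (rule log_convex_first_ratio_le_growth)
      show "0 \<le> a n" for n
        by (simp add: a_def A_norm_nonneg[OF A])
      show "(a (Suc n))\<^sup>2 \<le> a n * a (Suc (Suc n))" for n
      proof -
        have "(a (Suc n))\<^sup>2 = cmod (A_inner A ((P ^^ Suc n) x) ((P ^^ Suc n) x))"
          by (simp add: a_def A_inner_self[OF A] norm_power A_norm_nonneg[OF A])
        also have "\<dots> = cmod (A_inner A ((P ^^ n) x) ((P ^^ Suc (Suc n)) x))"
          using symmetric by simp
        also have "\<dots> \<le> a n * a (Suc (Suc n))"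
          unfolding a_def by (rule A_Cauchy_Schwarz[OF A])
        finally show ?thesis .
      qed
      show "a n \<le> (C * norm x) * K ^ n" for n
      proof -
        have "norm ((P ^^ n) x) \<le> norm x * K ^ n"
        proof (induction n)
          case (Suc n)
          have "norm (P ((P ^^ n) x)) \<le> K * (norm x * K ^ n)"
            using K(2)[of "(P ^^ n) x"] mult_left_mono[OF Suc, of K] K(1) by linarith
          then show ?case
            by (simp add: mult_ac)
        qed simp
        then show ?thesis
          using C(2)[of "(P ^^ n) x"] mult_left_mono[of "norm ((P ^^ n) x)" "norm x * K ^ n" C] C(1)
          unfolding a_def mult.assoc by linarith
      qed
    qed (use K in simp)
    then show ?thesis
      by (simp add: a_def)
  qed
  then show ?thesis
    using K(1) by (auto simp: A_bounded_def intro!: exI[of _ K])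
qed

text \<open>If \<open>X\<close> is an \<open>A\<close>-adjoint of \<open>T\<close>, then \<open>X T\<close> is symmetric for the semi-inner product and
  \<open>\<parallel>T x\<parallel>\<^sub>A\<^sup>2 = \<langle>x, X T x\<rangle>\<^sub>A\<close>, which reduces to the symmetric case.\<close>

lemma A_adjointable_imp_A_bounded:
  assumes A: "positive_op A" and T: "T \<in> A_adjointable A"
  shows "A_bounded A T"
proof -
  obtain X where X: "bounded_clinear X" "\<And>x y. A_inner A (T x) y = A_inner A x (X y)"
    using A_adjointable_adjoint[OF A T] by metis
  have "A_bounded A (\<lambda>x. X (T x))"
  proof (rule symmetric_imp_A_bounded[OF A])
    show "bounded_clinear (\<lambda>x. X (T x))"
      using T by (auto simp: A_adjointable_def intro: bounded_clinear_compose[OF X(1)])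
    show "A_inner A (X (T x)) y = A_inner A x (X (T y))" for x y
      by (metis X(2) A_inner_commute[OF A])
  qed
  then obtain M where M: "M \<ge> 0" "\<And>x. A_norm A (X (T x)) \<le> M * A_norm A x"
    by (auto simp: A_bounded_def)
  have "A_norm A (T x) \<le> sqrt M * A_norm A x" for x
  proof (rule power2_le_imp_le)
    have "(A_norm A (T x))\<^sup>2 = cmod (A_inner A x (X (T x)))"
      by (simp add: A_inner_self[OF A] norm_power A_norm_nonneg[OF A] flip: X(2))
    also have "\<dots> \<le> A_norm A x * (M * A_norm A x)"
      using A_Cauchy_Schwarz[OF A, of x "X (T x)"]
        mult_left_mono[OF M(2)[of x] A_norm_nonneg[OF A, of x]] by linarith
    finally show "(A_norm A (T x))\<^sup>2 \<le> (sqrt M * A_norm A x)\<^sup>2"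
      using M(1) by (simp add: power_mult_distrib) (simp add: power2_eq_square mult_ac)
  qed (use M A_norm_nonneg[OF A] in simp)
  then show ?thesis
    using M(1) by (auto simp: A_bounded_def intro!: exI[of _ "sqrt M"])
qed

lemma A_bounded_add:
  assumes A: "positive_op A" and S: "A_bounded A S" and T: "A_bounded A T"
  shows "A_bounded A (\<lambda>x. S x + T x)"
proof -
  obtain M N where M: "M \<ge> 0" "\<And>x. A_norm A (S x) \<le> M * A_norm A x"
    and N: "N \<ge> 0" "\<And>x. A_norm A (T x) \<le> N * A_norm A x"
    using S T by (auto simp: A_bounded_def)
  have "A_norm A (S x + T x) \<le> (M + N) * A_norm A x" for x
    using A_norm_triangle[OF A, of "S x" "T x"] M(2)[of x] N(2)[of x] by (simp add: distrib_right)
  then show ?thesis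
    using M(1) N(1) by (auto simp: A_bounded_def intro!: exI[of _ "M + N"])
qed

lemma A_bounded_uminus: "positive_op A \<Longrightarrow> A_bounded A T \<Longrightarrow> A_bounded A (\<lambda>x. - T x)"
  by (simp add: A_bounded_def A_norm_uminus)

lemma A_bounded_diff:
  "positive_op A \<Longrightarrow> A_bounded A S \<Longrightarrow> A_bounded A T \<Longrightarrow> A_bounded A (\<lambda>x. S x - T x)"
  using A_bounded_add[of A S "\<lambda>x. - T x"] A_bounded_uminus[of A T] by simp

section \<open>The operator seminorm and the numerical radius as pointwise bounds\<close>

text \<open>Iterating \<open>y \<mapsto> y - c A y\<close> from \<open>x\<close> stays in \<open>x + range A\<close>. For \<open>c = 1/C\<^sup>2\<close> with
  \<open>\<parallel>y\<parallel>\<^sub>A \<le> C \<parallel>y\<parallel>\<close>, one has \<open>c \<parallel>A y\<parallel>\<^sup>2 \<le> \<parallel>y\<parallel>\<^sub>A\<^sup>2\<close>, and each step lowers the squared norm by at least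
  \<open>c \<parallel>y\<parallel>\<^sub>A\<^sup>2\<close>. As the total decrease is at most \<open>\<parallel>x\<parallel>\<^sup>2\<close>, the seminorms of the iterates cannot stay
  away from \<open>0\<close>. This replaces an orthogonal projection onto \<open>closure (range A)\<close>.\<close>

lemma range_A_dense:
  assumes A: "positive_op A" and e: "e > 0"
  obtains r where "r \<in> range A" "A_norm A (x - r) < e"
proof -
  note clin = positive_op_bounded_clinear[OF A]
  obtain C where C: "C > 0" "\<And>x. A_norm A x \<le> C * norm x"
    using A_norm_le_norm[OF A] by metis
  define c where "c = 1 / C\<^sup>2"
  have c: "c > 0"
    using C by (simp add: c_def)
  have A_le: "c * (norm (A y))\<^sup>2 \<le> (A_norm A y)\<^sup>2" for y
  proof -
    have "(norm (A y))\<^sup>2 = cmod (A_inner A y (A y))"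
      by (simp add: A_inner_def cinner_self norm_power)
    also have "\<dots> \<le> A_norm A y * (C * norm (A y))"
      using A_Cauchy_Schwarz[OF A, of y "A y"]
        mult_left_mono[OF C(2)[of "A y"] A_norm_nonneg[OF A, of y]] by linarith
    finally have "norm (A y) \<le> C * A_norm A y"
      using C(1) A_norm_nonneg[OF A, of y]
      by (cases "A y = 0") (simp_all add: power2_eq_square mult_ac)
    then have "(norm (A y))\<^sup>2 \<le> (C * A_norm A y)\<^sup>2"
      by (simp add: power_mono)
    then show ?thesis
      using C(1) by (simp add: c_def power_mult_distrib field_simps)
  qed
  define B where "B y = y - c *\<^sub>R A y" for y
  have decrease: "c * (A_norm A y)\<^sup>2 \<le> (norm y)\<^sup>2 - (norm (B y))\<^sup>2" for y
  proof -
    have "(norm (B y))\<^sup>2 = (norm y)\<^sup>2 - 2 * (c * Re (cinner y (A y))) + (c * norm (A y))\<^sup>2"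
      using A_norm_sq_diff[OF positive_op_id, of y "c *\<^sub>R A y"] c
      by (simp add: A_norm_id A_inner_def B_def cinner_simps)
    also have "Re (cinner y (A y)) = (A_norm A y)\<^sup>2"
      using arg_cong[OF A_inner_self[OF A, of y], of Re] arg_cong[OF cinner_commute[of y "A y"], of Re]
      by (simp add: A_inner_def flip: of_real_power)
    also have "(c * norm (A y))\<^sup>2 \<le> c * (A_norm A y)\<^sup>2"
      using mult_left_mono[OF A_le[of y], of c] c by (simp add: power2_eq_square mult_ac)
    finally show ?thesis
      by simp
  qed
  have in_range: "x - (B ^^ n) x \<in> range A" for n
  proof (induction n)
    case 0
    then show ?case
      using bounded_clinear_zero[OF clin] by (auto simp: image_iff intro: exI[of _ 0])
  next
    case (Suc n)
    then obtain z where "x - (B ^^ n) x = A z"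
      by auto
    then have "x - (B ^^ Suc n) x = A (z + c *\<^sub>R (B ^^ n) x)"
      by (simp add: B_def bounded_clinear_simps clin algebra_simps)
    then show ?case
      by blast
  qed
  have "\<exists>n. A_norm A ((B ^^ n) x) < e"
  proof (rule ccontr)
    assume "\<not> ?thesis"
    then have large: "e \<le> A_norm A ((B ^^ n) x)" for n
      by (simp add: not_less)
    have "real n * (c * e\<^sup>2) \<le> (norm x)\<^sup>2 - (norm ((B ^^ n) x))\<^sup>2" for n
    proof (induction n)
      case (Suc n)
      have "c * e\<^sup>2 \<le> c * (A_norm A ((B ^^ n) x))\<^sup>2"
        using c e large[of n] by (intro mult_left_mono power_mono) auto
      then show ?case
        using Suc decrease[of "(B ^^ n) x"] by (simp add: distrib_right)
    qed simp
    then have "real n * (c * e\<^sup>2) \<le> (norm x)\<^sup>2" for n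
      by (smt (verit) zero_le_power2)
    moreover obtain n where "(norm x)\<^sup>2 < real n * (c * e\<^sup>2)"
      using reals_Archimedean3[of "c * e\<^sup>2"] c e by auto
    ultimately show False
      by (meson not_less)
  qed
  then obtain n where "A_norm A (x - (x - (B ^^ n) x)) < e"
    by auto
  with in_range that show ?thesis
    by blast
qed

lemma A_opnorm_bdd_above:
  assumes A: "positive_op A" and T: "A_bounded A T"
  shows "bdd_above (insert 0 {A_norm A (T x) / A_norm A x |x. x \<in> closure (range A) \<and> x \<noteq> 0})"
proof -
  obtain M where M: "M \<ge> 0" "\<And>x. A_norm A (T x) \<le> M * A_norm A x"
    using T by (auto simp: A_bounded_def)
  have "A_norm A (T x) / A_norm A x \<le> M" for x
    using M(1) M(2)[of x] A_norm_nonneg[OF A, of x]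
    by (cases "A_norm A x = 0") (simp_all add: divide_le_eq)
  with M(1) show ?thesis
    by (auto intro!: bdd_aboveI[of _ M])
qed

lemma A_opnorm_nonneg:
  assumes "positive_op A" and "A_bounded A T"
  shows "0 \<le> A_opnorm A T"
  unfolding A_opnorm_def by (intro cSup_upper A_opnorm_bdd_above[OF assms]) simp

text \<open>The supremum defining the seminorm sees only \<open>closure (range A)\<close>. Its bound extends to the
  whole space because \<open>range A\<close> is dense in the seminorm and \<open>T\<close> is continuous in it.\<close>

lemma A_norm_le_A_opnorm:
  assumes A: "positive_op A" and T: "A_bounded A T" and clin: "bounded_clinear T"
  shows "A_norm A (T x) \<le> A_opnorm A T * A_norm A x"
proof (rule field_le_epsilon)
  obtain M where M: "M \<ge> 0" "\<And>x. A_norm A (T x) \<le> M * A_norm A x"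
    using T by (auto simp: A_bounded_def)
  define N where "N = A_opnorm A T"
  have N: "N \<ge> 0"
    unfolding N_def by (rule A_opnorm_nonneg[OF A T])
  have on_range: "A_norm A (T r) \<le> N * A_norm A r" if "r \<in> range A" for r
  proof (cases "A_norm A r = 0")
    case True
    then show ?thesis
      using M(2)[of r] by simp
  next
    case False
    then have "r \<noteq> 0"
      by (auto simp: A_norm_def A_inner_def cinner_zero_right)
    then have "A_norm A (T r) / A_norm A r \<le> N"
      unfolding N_def A_opnorm_def using that closure_subset[of "range A"]
      by (intro cSup_upper A_opnorm_bdd_above[OF A T]) auto
    then show ?thesis
      using False A_norm_nonneg[OF A, of r] by (simp add: divide_le_eq split: if_splits)
  qed
  fix e :: real
  assume "e > 0"
  define d where "d = e / (M + N + 1)"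
  have d: "d > 0"
    using \<open>e > 0\<close> M(1) N by (simp add: d_def)
  then obtain r where r: "r \<in> range A" "A_norm A (x - r) < d"
    using range_A_dense[OF A] by metis
  have "A_norm A r \<le> A_norm A x + d"
    using A_norm_triangle_diff[OF A, of x "x - r"] r(2) by simp
  then have "A_norm A (T r) \<le> N * (A_norm A x + d)"
    using on_range[OF r(1)] mult_left_mono[OF _ N] order_trans by blast
  moreover have "A_norm A (T (x - r)) \<le> M * d"
    using M(2)[of "x - r"] mult_left_mono[OF less_imp_le[OF r(2)] M(1)] by linarith
  moreover have "A_norm A (T x) \<le> A_norm A (T r) + A_norm A (T (x - r))"
    using A_norm_triangle[OF A, of "T r" "T (x - r)"] by (simp add: bounded_clinear_diff[OF clin])
  moreover have "(M + N) * d \<le> e"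
    using \<open>e > 0\<close> M(1) N by (simp add: d_def field_simps)
  ultimately show "A_norm A (T x) \<le> A_opnorm A T * A_norm A x + e"
    unfolding N_def[symmetric] by (simp add: algebra_simps)
qed

lemma A_numerical_radius_bdd_above:
  assumes A: "positive_op A" and T: "A_bounded A T"
  shows "bdd_above (insert 0 {cmod (A_inner A (T x) x) |x. A_norm A x = 1})"
proof -
  obtain M where M: "M \<ge> 0" "\<And>x. A_norm A (T x) \<le> M * A_norm A x"
    using T by (auto simp: A_bounded_def)
  have "cmod (A_inner A (T x) x) \<le> M" if "A_norm A x = 1" for x
    using A_Cauchy_Schwarz[OF A, of "T x" x] M(2)[of x] that by simp
  with M(1) show ?thesis
    by (auto intro!: bdd_aboveI[of _ M])
qed

lemma A_numerical_radius_nonneg: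
  assumes "positive_op A" and "A_bounded A T"
  shows "0 \<le> A_numerical_radius A T"
  unfolding A_numerical_radius_def by (intro cSup_upper A_numerical_radius_bdd_above[OF assms]) simp

lemma A_inner_le_A_numerical_radius:
  assumes A: "positive_op A" and T: "A_bounded A T" and clin: "bounded_clinear T"
  shows "cmod (A_inner A (T x) x) \<le> A_numerical_radius A T * (A_norm A x)\<^sup>2"
proof (cases "A_norm A x = 0")
  case True
  then show ?thesis
    using A_Cauchy_Schwarz[OF A, of "T x" x] by simp
next
  case False
  define n where "n = A_norm A x"
  have n: "n > 0"
    using False A_norm_nonneg[OF A, of x] by (simp add: n_def)
  define u where "u = (1 / n) *\<^sub>R x"
  have "A_norm A u = 1"
    using n by (simp add: u_def A_norm_scaleR[OF A] flip: n_def)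
  then have "cmod (A_inner A (T u) u) \<le> A_numerical_radius A T"
    unfolding A_numerical_radius_def
    by (intro cSup_upper A_numerical_radius_bdd_above[OF A T]) auto
  moreover have "cmod (A_inner A (T u) u) = cmod (A_inner A (T x) x) / n\<^sup>2"
    using positive_op_bounded_clinear[OF A] n
    by (simp add: u_def bounded_clinear_scaleR[OF clin] A_inner_simps norm_mult norm_divide power2_eq_square)
  ultimately show ?thesis
    using n by (simp add: divide_le_eq flip: n_def)
qed

section \<open>The quadratic form of the block operator\<close>

text \<open>The coefficient matrix is the flip of the first and third coordinates. In its eigenbasis the
  components of \<open>(x, y, z)\<close> are, up to scaling, \<open>x + z\<close>, \<open>x - z\<close> and \<open>y\<close>, and only values
  \<open>\<langle>T v, v\<rangle>\<^sub>A\<close> remain.\<close>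

lemma flip_form_bound:
  assumes A: "positive_op A" and T: "A_bounded A T" and clin: "bounded_clinear T"
  shows "cmod (A_inner A (T z) x + A_inner A (T y) y + A_inner A (T x) z)
    \<le> A_numerical_radius A T * ((A_norm A x)\<^sup>2 + (A_norm A y)\<^sup>2 + (A_norm A z)\<^sup>2)"
proof -
  define w where "w = A_numerical_radius A T"
  note bound = A_inner_le_A_numerical_radius[OF A T clin, folded w_def]
  have "2 * (A_inner A (T z) x + A_inner A (T x) z)
      = A_inner A (T (x + z)) (x + z) - A_inner A (T (x - z)) (x - z)"
    using positive_op_bounded_clinear[OF A] by (simp add: A_inner_simps bounded_clinear_simps clin)
  then have "2 * cmod (A_inner A (T z) x + A_inner A (T x) z)
      = cmod (A_inner A (T (x + z)) (x + z) - A_inner A (T (x - z)) (x - z))"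
    by (metis norm_mult norm_numeral)
  also have "\<dots> \<le> w * (A_norm A (x + z))\<^sup>2 + w * (A_norm A (x - z))\<^sup>2"
    using norm_triangle_ineq4 bound[of "x + z"] bound[of "x - z"] by (smt (verit))
  also have "\<dots> = w * ((A_norm A (x + z))\<^sup>2 + (A_norm A (x - z))\<^sup>2)"
    by (simp only: distrib_left)
  also have "\<dots> = 2 * (w * ((A_norm A x)\<^sup>2 + (A_norm A z)\<^sup>2))"
    by (simp only: A_parallelogram[OF A] mult.left_commute)
  finally have "cmod (A_inner A (T z) x + A_inner A (T x) z) \<le> w * ((A_norm A x)\<^sup>2 + (A_norm A z)\<^sup>2)"
    by simp
  moreover have "cmod (A_inner A (T z) x + A_inner A (T y) y + A_inner A (T x) z)
      \<le> cmod (A_inner A (T z) x + A_inner A (T x) z) + cmod (A_inner A (T y) y)"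
    using norm_triangle_ineq[of "A_inner A (T z) x + A_inner A (T x) z" "A_inner A (T y) y"]
    by (simp add: ac_simps)
  ultimately show ?thesis
    using bound[of y] by (simp add: w_def algebra_simps)
qed

text \<open>Written through \<open>S = T1 + T2\<close> and \<open>D = T1 - T2\<close>, the form pairs \<open>y\<close> with the vectors \<open>x + \<i> z\<close> and \<open>x - \<i> z\<close> only.
  These have squared seminorms adding up to \<open>2 (\<parallel>x\<parallel>\<^sub>A\<^sup>2 + \<parallel>z\<parallel>\<^sub>A\<^sup>2)\<close>, so that the arithmetic-geometric
  mean inequality produces the constant \<open>1/2\<close>.\<close>

lemma cross_form_bound:
  assumes A: "positive_op A"
    and clin: "bounded_clinear T1" "bounded_clinear T2"
    and S: "\<And>x. A_norm A (T1 x + T2 x) \<le> s * A_norm A x" and s: "s \<ge> 0"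
    and D: "\<And>x. A_norm A (T1 x - T2 x) \<le> d * A_norm A x" and d: "d \<ge> 0"
  shows "cmod (A_inner A (T2 y) x + A_inner A (T2 x) y
      - \<i> * A_inner A (T1 z) y - \<i> * A_inner A (T1 y) z)
    \<le> (s + d) / 2 * ((A_norm A x)\<^sup>2 + (A_norm A y)\<^sup>2 + (A_norm A z)\<^sup>2)"
    (is "cmod ?F \<le> _")
proof -
  define S where "S x = T1 x + T2 x" for x
  define D where "D x = T1 x - T2 x" for x
  define p where "p = x + \<i> *\<^sub>C z"
  define q where "q = x - \<i> *\<^sub>C z"
  note A_simps = A_inner_simps positive_op_bounded_clinear[OF A]
  have "2 * ?F = A_inner A (S y) p - A_inner A (D y) q + A_inner A (S q) y - A_inner A (D p) y"
    by (simp add: S_def D_def p_def q_def A_simps bounded_clinear_simps clin) (simp add: algebra_simps)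
  then have "2 * cmod ?F
      = cmod (A_inner A (S y) p - A_inner A (D y) q + A_inner A (S q) y - A_inner A (D p) y)"
    by (metis norm_mult norm_numeral)
  also have "\<dots> \<le> cmod (A_inner A (S y) p) + cmod (A_inner A (D y) q)
      + cmod (A_inner A (S q) y) + cmod (A_inner A (D p) y)"
    by (smt (verit) norm_triangle_ineq norm_triangle_ineq4)
  also have "\<dots> \<le> s * A_norm A y * A_norm A p + d * A_norm A y * A_norm A q
      + s * A_norm A q * A_norm A y + d * A_norm A p * A_norm A y"
  proof -
    have "cmod (A_inner A u v) \<le> k * A_norm A v" if "A_norm A u \<le> k" for u v k
      using A_Cauchy_Schwarz[OF A, of u v] mult_right_mono[OF that A_norm_nonneg[OF A, of v]]
      by linarith
    then show ?thesis
      using assms(4,6) unfolding S_def D_def by (intro add_mono) auto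
  qed
  also have "\<dots> = (s + d) * (A_norm A y * (A_norm A p + A_norm A q))"
    by (simp add: algebra_simps)
  also have "\<dots> \<le> (s + d) * ((A_norm A x)\<^sup>2 + (A_norm A y)\<^sup>2 + (A_norm A z)\<^sup>2)"
  proof (rule mult_left_mono)
    have "(A_norm A p)\<^sup>2 + (A_norm A q)\<^sup>2 = 2 * ((A_norm A x)\<^sup>2 + (A_norm A z)\<^sup>2)"
      unfolding p_def q_def by (simp add: A_parallelogram[OF A] A_norm_scaleC[OF A])
    moreover have "0 \<le> (A_norm A y - A_norm A p)\<^sup>2" "0 \<le> (A_norm A y - A_norm A q)\<^sup>2"
      by simp_all
    ultimately show "A_norm A y * (A_norm A p + A_norm A q)
        \<le> (A_norm A x)\<^sup>2 + (A_norm A y)\<^sup>2 + (A_norm A z)\<^sup>2"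
      by (simp add: power2_diff algebra_simps)
  qed (use s d in simp)
  finally show ?thesis
    by simp
qed

section \<open>The numerical radius inequality\<close>

lemma A_inner_diag3:
  "A_inner (diag3 A) (x, y, z) (x', y', z') = A_inner A x x' + A_inner A y y' + A_inner A z z'"
  by (simp add: A_inner_def diag3_def block3_def cinner_prod_def)

lemma A_norm_diag3_sq:
  assumes "positive_op A"
  shows "(A_norm (diag3 A) (x, y, z))\<^sup>2 = (A_norm A x)\<^sup>2 + (A_norm A y)\<^sup>2 + (A_norm A z)\<^sup>2"
  unfolding A_norm_def[of "diag3 A"] by (simp add: A_inner_diag3 A_inner_self[OF assms] flip: of_real_power)

theorem corollary4p4:
  fixes A T1 T2 T3 :: "'a::chilbert_space \<Rightarrow> 'a"
  assumes "positive_op A"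
    and "T1 \<in> A_adjointable A" and "T2 \<in> A_adjointable A" and "T3 \<in> A_adjointable A"
  shows "A_numerical_radius (diag3 A)
      (block3 T1 T2 T3
              T2 T3 (\<lambda>x. (- \<i>) *\<^sub>C T1 x)
              T3 (\<lambda>x. (- \<i>) *\<^sub>C T1 x) (\<lambda>x. (- \<i>) *\<^sub>C T2 x))
    \<le> A_numerical_radius A T3 + max (A_numerical_radius A T1) (A_numerical_radius A T2)
      + 1 / sqrt 2 * (A_opnorm A (\<lambda>x. T1 x - T2 x) + A_opnorm A (\<lambda>x. T1 x + T2 x))"
    (is "A_numerical_radius _ ?M \<le> ?rhs")
proof -
  note A = assms(1)
  have clin: "bounded_clinear T1" "bounded_clinear T2" "bounded_clinear T3"
    using assms(2-4) by (auto simp: A_adjointable_def)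
  note bounded = assms(2-4)[THEN A_adjointable_imp_A_bounded[OF A]]
  define w where "w = max (A_numerical_radius A T1) (A_numerical_radius A T2)"
  define d where "d = A_opnorm A (\<lambda>x. T1 x - T2 x)"
  define s where "s = A_opnorm A (\<lambda>x. T1 x + T2 x)"
  have w: "w \<ge> 0"
    using A_numerical_radius_nonneg[OF A bounded(1)] by (simp add: w_def)
  have d: "d \<ge> 0" "\<And>x. A_norm A (T1 x - T2 x) \<le> d * A_norm A x"
    unfolding d_def using clin bounded
    by (auto intro!: A_opnorm_nonneg A_norm_le_A_opnorm A A_bounded_diff bounded_clinear_minus)
  have s: "s \<ge> 0" "\<And>x. A_norm A (T1 x + T2 x) \<le> s * A_norm A x"
    unfolding s_def using clin bounded
    by (auto intro!: A_opnorm_nonneg A_norm_le_A_opnorm A A_bounded_add bounded_clinear_plus)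
  have half: "(s + d) / 2 \<le> 1 / sqrt 2 * (d + s)"
  proof -
    have "1 / 2 \<le> 1 / sqrt (2 :: real)"
      using real_sqrt_le_mono[of 2 4] by (intro divide_left_mono) auto
    then show ?thesis
      using mult_right_mono[of "1 / 2" "1 / sqrt 2" "s + d"] s(1) d(1) by (simp add: add.commute)
  qed
  have rhs: "?rhs = A_numerical_radius A T3 + w + 1 / sqrt 2 * (d + s)"
    by (simp only: w_def d_def s_def)
  have diagonal: "cmod (A_inner A (T1 x) x - \<i> * A_inner A (T2 z) z)
      \<le> w * ((A_norm A x)\<^sup>2 + (A_norm A y)\<^sup>2 + (A_norm A z)\<^sup>2)" for x y z
  proof -
    have "cmod (A_inner A (T1 x) x - \<i> * A_inner A (T2 z) z)
        \<le> cmod (A_inner A (T1 x) x) + cmod (A_inner A (T2 z) z)"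
      using norm_triangle_ineq4[of "A_inner A (T1 x) x" "\<i> * A_inner A (T2 z) z"]
      by (simp add: norm_mult)
    also have "\<dots> \<le> w * (A_norm A x)\<^sup>2 + w * (A_norm A z)\<^sup>2"
      using A_inner_le_A_numerical_radius[OF A bounded(1) clin(1), of x]
        A_inner_le_A_numerical_radius[OF A bounded(2) clin(2), of z]
      by (intro add_mono) (auto simp: w_def elim!: order_trans intro!: mult_right_mono)
    also have "\<dots> \<le> w * ((A_norm A x)\<^sup>2 + (A_norm A y)\<^sup>2 + (A_norm A z)\<^sup>2)"
      using w by (simp add: distrib_left)
    finally show ?thesis .
  qed
  have form_bound: "cmod (A_inner (diag3 A) (?M u) u) \<le> ?rhs" if u: "A_norm (diag3 A) u = 1" for u
  proof -
    obtain x y z where xyz: "u = (x, y, z)"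
      by (cases u) auto
    have one: "(A_norm A x)\<^sup>2 + (A_norm A y)\<^sup>2 + (A_norm A z)\<^sup>2 = 1"
      using A_norm_diag3_sq[OF A, of x y z] u by (simp add: xyz)
    define a b c where "a = A_inner A (T3 z) x + A_inner A (T3 y) y + A_inner A (T3 x) z"
      and "b = A_inner A (T1 x) x - \<i> * A_inner A (T2 z) z"
      and "c = A_inner A (T2 y) x + A_inner A (T2 x) y
        - \<i> * A_inner A (T1 z) y - \<i> * A_inner A (T1 y) z"
    have "A_inner (diag3 A) (?M u) u = a + b + c"
      using positive_op_bounded_clinear[OF A]
      by (simp add: xyz block3_def A_inner_diag3 A_inner_simps a_def b_def c_def)
    then have "cmod (A_inner (diag3 A) (?M u) u) \<le> cmod a + cmod b + cmod c"
      using norm_triangle_ineq[of "a + b" c] norm_triangle_ineq[of a b] by simp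
    also have "\<dots> \<le> A_numerical_radius A T3 + w + (s + d) / 2"
      using flip_form_bound[OF A bounded(3) clin(3), of z x y] diagonal[of x z y]
        cross_form_bound[OF A clin(1,2) s(2,1) d(2,1), of y x z]
      unfolding one a_def b_def c_def mult_1_right by linarith
    finally show ?thesis
      unfolding rhs using half by linarith
  qed
  have "0 \<le> ?rhs"
    using A_numerical_radius_nonneg[OF A bounded(3)] w s(1) d(1) unfolding rhs by simp
  then show ?thesis
    unfolding A_numerical_radius_def[of "diag3 A"]
    using form_bound by (intro cSup_least) auto
qed

end
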